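(* Let $a,b>0$ and let $f\in C([0,1])$ satisfy $f(0)=f(1)=0$ and suppose there is $k>0$ with $|f(s)|\le ks$ and $|f(s)|\le k(1-s)$ for every $s\in[0,1]$. Then the following hold. 1. If $f$ is of type A, then the set of the admissible speeds for the problem $$y'=c\,a\,\frac{\sqrt{y(2a+b^2y)}}{a+b^2y}-f(v),\qquad y(0)=0,\ y(1)=0,\ y>0\text{ on }(0,1),$$ is an interval $[c^*,+\infty)$, where $$\sqrt{\sup_{v\in(0,1]}\left(\frac{b^2}{a^2}\frac{F(v)^2}{v^2}+\frac{2}{a}\frac{F(v)}{v^2}\right)}\le c^*\le \sup_{v\in(0,1]}\left(\frac{b}{a}f(v)+2\sqrt{\frac{f(v)}{av}}\right).$$ 2. If $f$ is of type B or C, then there exists a unique admissible speed $c^*$, and it satisfies $$\frac{1}{R_{a,b}(F(1)-F(\alpha))}\sup_{v\in(0,1]}\frac{F(v)}{av}\le c^*\le\frac{1}{\alpha}\sqrt{\frac{b^2}{a^2}(F(1)-F(\alpha))^2+\frac{2}{a}(F(1)-F(\alpha))}.$$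
   Context: Notation: $F(v)=\int_0^v f(s)\,ds$ and $R_{a,b}(s)=\frac{\sqrt{s(2a+b^2s)}}{a+b^2s}$ for $s\ge 0$. Types of reaction terms $f$: - type A: $f(u)>0$ for every $u\in(0,1)$; - type B: there exists $\alpha\in(0,1)$ with $f(u)=0$ for $u\in[0,\alpha]$ and $f(u)>0$ for $u\in(\alpha,1)$; - type C: there exists $\alpha\in(0,1)$ with $f<0$ on $(0,\alpha)$ and $f>0$ on $(\alpha,1)$, and moreover $\int_0^1 f(s)\,ds\ge 0$. In types B and C, $\alpha$ denotes this number. In the boundary value problem, $y=y(v)$ is a (classical) function of $v\in[0,1]$ and $'$ is the derivative with respect to $v$. A number $c\in\mathbb{R}$ is called an admissible speed if this two-point problem has a solution. *)

theory Defs
  imports "HOL-Analysis.Analysis"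
begin

(* Functions on [0,1] are represented by total functions of type real => real; only their
   values on [0,1] matter in the definitions below. *)

definition primF :: "(real \<Rightarrow> real) \<Rightarrow> real \<Rightarrow> real" where
  "primF f v = integral {0..v} f"

definition Rfun :: "real \<Rightarrow> real \<Rightarrow> real \<Rightarrow> real" where
  "Rfun a b s = sqrt (s * (2 * a + b\<^sup>2 * s)) / (a + b\<^sup>2 * s)"

definition type_A :: "(real \<Rightarrow> real) \<Rightarrow> bool" where
  "type_A f \<longleftrightarrow> (\<forall>u\<in>{0<..<1}. f u > 0)"

(* In types B and C the number alpha is an explicit argument; it is determined by f. *)

definition type_B :: "(real \<Rightarrow> real) \<Rightarrow> real \<Rightarrow> bool" where
  "type_B f \<alpha> \<longleftrightarrow> \<alpha> \<in> {0<..<1} \<and> (\<forall>u\<in>{0..\<alpha>}. f u = 0) \<and> (\<forall>u\<in>{\<alpha><..<1}. f u > 0)"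

definition type_C :: "(real \<Rightarrow> real) \<Rightarrow> real \<Rightarrow> bool" where
  "type_C f \<alpha> \<longleftrightarrow> \<alpha> \<in> {0<..<1} \<and> (\<forall>u\<in>{0<..<\<alpha>}. f u < 0) \<and> (\<forall>u\<in>{\<alpha><..<1}. f u > 0)
     \<and> integral {0..1} f \<ge> 0"

(* The derivative is taken within [0,1], hence one-sided at the two end points. For continuous f
   the right-hand side is continuous on [0,1], so solutions are automatically C^1 on [0,1], and
   any continuous y on [0,1] satisfying the equation on (0,1) satisfies it at 0 and 1 as well. *)

definition solves_bvp ::
  "real \<Rightarrow> real \<Rightarrow> (real \<Rightarrow> real) \<Rightarrow> real \<Rightarrow> (real \<Rightarrow> real) \<Rightarrow> bool" where
  "solves_bvp a b f c y \<longleftrightarrow>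
     (\<forall>v\<in>{0..1}. (y has_real_derivative
        (c * a * (sqrt (y v * (2 * a + b\<^sup>2 * y v)) / (a + b\<^sup>2 * y v)) - f v)) (at v within {0..1}))
     \<and> y 0 = 0 \<and> y 1 = 0 \<and> (\<forall>v\<in>{0<..<1}. y v > 0)"

definition admissible_speed :: "real \<Rightarrow> real \<Rightarrow> (real \<Rightarrow> real) \<Rightarrow> real \<Rightarrow> bool" where
  "admissible_speed a b f c \<longleftrightarrow> (\<exists>y. solves_bvp a b f c y)"

end

theory Submission
  imports Defs
begin

text \<open>
  Write \<open>R = Rfun a b\<close>, so that the equation reads \<open>y' = c * a * R y - f v\<close>, and \<open>F\<close> for the
  primitive of \<open>f\<close>. Everything rests on two structural facts.

  First, \<open>R\<close> is nondecreasing. Hence for \<open>c \<ge> 0\<close> the distance between two solutions does not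
  increase as \<open>v\<close> decreases, although \<open>R\<close> behaves like a square root at \<open>0\<close> and is not Lipschitz
  there. The terminal value problem \<open>y 1 = 0\<close>, with \<open>R (max 0 y)\<close> in place of \<open>R y\<close>, therefore
  has exactly one solution \<open>flow c\<close> on \<open>[0,1]\<close> (\<open>monotone_terminal_value_problem\<close>), and
  \<open>flow c v\<close> is nonincreasing and Lipschitz in \<open>c\<close> (\<open>terminal_solution_antimono\<close>,
  \<open>terminal_solution_lipschitz\<close>). If the integral of \<open>f\<close> is nonnegative, admissible speeds are
  nonnegative, and \<open>c\<close> is admissible iff \<open>flow c\<close> vanishes at \<open>0\<close> and is positive on \<open>(0,1)\<close>.

  Second, the function \<open>rect y = sqrt (y * (2 * a + b\<^sup>2 * y)) / a\<close> is a primitive of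
  \<open>1 / (a * R)\<close>. In the coordinate \<open>z = rect y\<close> the equation is \<open>z' = c - f / (a * R y)\<close>, in which
  the speed enters additively.

  Positive reaction. Here \<open>flow c > 0\<close> on \<open>(0,1)\<close> automatically, so \<open>c\<close> is admissible iff
  \<open>flow c 0 = 0\<close>. Since \<open>flow c 0 \<ge> 0\<close> is nonincreasing and continuous in \<open>c\<close>, the admissible
  speeds form a closed half-line as soon as there is one. The lower bound holds because
  \<open>rect (y + F)\<close> grows at rate at most \<open>c\<close>. For the upper bound, \<open>rect (flow c)\<close> is compared with
  the barrier \<open>w v = (sqrt (1 + b * c * v) - 1) / b\<close>. It is found by replacing \<open>f\<close> by the largest
  \<open>f\<close> allowed by \<open>b / a * f v + 2 * sqrt (f v / (a * v)) \<le> c\<close>: with \<open>w v = h v * v\<close>, the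
  function \<open>h\<close> is the nonnegative root of \<open>b * v * h\<^sup>2 + 2 * h = c\<close>.

  Reaction nonpositive on \<open>(0,\<alpha>)\<close>. There \<open>f \<le> 0\<close> makes the equation for \<open>rect y\<close>
  dissipative forwards as well, and it grows at rate at least \<open>c\<close>. A larger speed thus gives a
  strictly larger \<open>rect y\<close> at \<open>\<alpha>\<close> when followed from the left but a smaller one when followed
  from the right, which proves uniqueness. For existence one takes the largest \<open>c\<close> for which
  \<open>flow c v \<ge> 0\<close> and \<open>rect (flow c v) \<ge> c * v\<close> on \<open>[0,\<alpha>]\<close>. The bounds follow from this growth and
  from \<open>0 \<le> flow c \<le> F 1 - F \<alpha>\<close>, which holds for admissible \<open>c\<close>.
\<close>

section \<open>Differential inequalities and uniform limits\<close>

text \<open>A comparison principle: a function that can only increase while it is positive, and is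
  positive at \<open>s\<close>, stays above its value at \<open>s\<close>. Where it is not positive it
  need not even be differentiable.\<close>

lemma le_of_deriv_nonneg_where_positive:
  fixes D :: "real \<Rightarrow> real"
  assumes st: "s \<le> t" and cont: "continuous_on {s..t} D"
    and deriv: "\<And>v. s < v \<Longrightarrow> v < t \<Longrightarrow> D v > 0 \<Longrightarrow> \<exists>d\<ge>0. (D has_real_derivative d) (at v)"
    and pos: "D s > 0"
  shows "D s \<le> D t"
proof (rule ccontr)
  assume neg: "\<not> D s \<le> D t"
  \<comment> \<open>Up to the first time at which the positive level \<open>m\<close> is reached, \<open>D\<close> is positive.\<close>
  define m where "m = (max (D t) 0 + D s) / 2"
  have m: "D t < m" "0 < m" "m < D s"
    using neg pos by (auto simp: m_def max_def)
  define A where "A = {s..t} \<inter> D -` {..m}"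
  have "closed A"
    unfolding A_def by (intro continuous_closed_preimage cont) auto
  moreover have "t \<in> A"
    using m st by (auto simp: A_def)
  moreover have bdd: "bdd_below A"
    by (auto simp: A_def intro!: bdd_belowI[of _ s])
  ultimately have inA: "Inf A \<in> A"
    using closed_contains_Inf by blast
  then have s_le: "s \<le> Inf A" and le_t: "Inf A \<le> t" and Dle: "D (Inf A) \<le> m"
    by (auto simp: A_def)
  have above: "D v > m" if "s \<le> v" "v < Inf A" for v
  proof (rule ccontr)
    assume "\<not> D v > m"
    then have "v \<in> A" using that le_t by (auto simp: A_def)
    then show False using cInf_lower[OF _ bdd] that by fastforce
  qed
  have "D s \<le> D (Inf A)"
  proof (rule DERIV_nonneg_imp_increasing_open[OF s_le])
    show "\<exists>d. (D has_real_derivative d) (at x) \<and> 0 \<le> d" if "s < x" "x < Inf A" for x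
      using deriv[of x] above[of x] that le_t m by force
    show "continuous_on {s..Inf A} D"
      by (rule continuous_on_subset[OF cont]) (use le_t in auto)
  qed
  then show False using Dle m by linarith
qed

lemma has_real_derivative_uniform_limit:
  fixes Y d :: "nat \<Rightarrow> real \<Rightarrow> real"
  assumes deriv: "\<And>n v. v \<in> {s..t} \<Longrightarrow> (Y n has_real_derivative d n v) (at v within {s..t})"
    and Y: "uniform_limit {s..t} Y y sequentially"
    and d: "uniform_limit {s..t} d d' sequentially"
    and v: "v \<in> {s..t}"
  shows "(y has_real_derivative d' v) (at v within {s..t})"
proof -
  have "\<exists>g. \<forall>x\<in>{s..t}. (\<lambda>n. Y n x) \<longlonglongrightarrow> g x \<and> (g has_derivative (*) (d' x)) (at x within {s..t})"
  proof (rule has_derivative_sequence)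
    show "convex {s..t}" by simp
    show "(Y n has_derivative (*) (d n x)) (at x within {s..t})" if "x \<in> {s..t}" for n x
      using deriv[OF that] by (simp add: has_field_derivative_def)
    show "\<forall>\<^sub>F n in sequentially. \<forall>x\<in>{s..t}. \<forall>h. norm (d n x * h - d' x * h) \<le> e * norm h"
      if "e > 0" for e
      using uniform_limitD[OF d that]
      by eventually_elim (auto simp: dist_real_def abs_mult left_diff_distrib[symmetric]
          intro!: mult_right_mono intro: less_imp_le)
    show "v \<in> {s..t}" by fact
    show "(\<lambda>n. Y n v) \<longlonglongrightarrow> y v" by (rule tendsto_uniform_limitI[OF Y v])
  qed
  then obtain g where g: "\<And>x. x \<in> {s..t} \<Longrightarrow> (\<lambda>n. Y n x) \<longlonglongrightarrow> g x"
    "\<And>x. x \<in> {s..t} \<Longrightarrow> (g has_real_derivative d' x) (at x within {s..t})"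
    unfolding has_field_derivative_def by blast
  have "g x = y x" if "x \<in> {s..t}" for x
    using LIMSEQ_unique[OF g(1)[OF that] tendsto_uniform_limitI[OF Y that]] .
  then show ?thesis
    using has_derivative_transform[OF v, of y g] g(2)[OF v] by (simp add: has_field_derivative_def)
qed

section \<open>The terminal value problem for a monotone nonlinearity\<close>

text \<open>Picard iteration, on all of \<open>[0,1]\<close> at once.\<close>

lemma lipschitz_terminal_value_problem:
  fixes f h :: "real \<Rightarrow> real"
  assumes f: "continuous_on {0..1} f" and L: "L > 0"
    and lip: "\<And>x y. \<bar>h x - h y\<bar> \<le> L * \<bar>x - y\<bar>"
  shows "\<exists>y. y 1 = 0 \<and> (\<forall>v\<in>{0..1}. (y has_real_derivative h (y v) - f v) (at v within {0..1}))"
proof -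
  define Y where "Y = rec_nat (\<lambda>v::real. 0::real) (\<lambda>n u v. integral {0..v} (\<lambda>s. h (u s) - f s)
    - integral {0..1} (\<lambda>s. h (u s) - f s))"
  have Y0: "Y 0 = (\<lambda>v. 0)" by (simp add: Y_def)
  have YS: "Y (Suc n) = (\<lambda>v. integral {0..v} (\<lambda>s. h (Y n s) - f s)
    - integral {0..1} (\<lambda>s. h (Y n s) - f s))" for n
    by (simp add: Y_def)
  have conth: "continuous_on UNIV h"
    using L lip by (intro lipschitz_on_continuous_on[of L]) (auto simp: lipschitz_on_def dist_real_def)
  have contu: "continuous_on {0..1} (\<lambda>s. h (u s) - f s)" if "continuous_on {0..1} u" for u
    by (intro continuous_intros f that continuous_on_compose2[OF conth]) auto
  have derivS: "(Y (Suc n) has_real_derivative h (Y n v) - f v) (at v within {0..1})"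
    if "continuous_on {0..1} (Y n)" "v \<in> {0..1}" for n v
    unfolding YS
    by (rule DERIV_cong[OF DERIV_diff[OF integral_has_real_derivative[OF contu[OF that(1)] that(2)]
            DERIV_const]]) simp
  have cont: "continuous_on {0..1} (Y n)" for n
  proof (induction n)
    case (Suc n)
    then show ?case by (rule DERIV_continuous_on[OF derivS])
  qed (simp add: Y0)
  note deriv = derivS[OF cont]
  have deriv': "(Y (Suc n) has_real_derivative h (Y n v) - f v) (at v)" if "0 < v" "v < 1" for n v
    using deriv[of v n] that by (simp add: at_within_Icc_at)
  have Y1: "Y n 1 = 0" for n
    by (cases n) (auto simp: Y0 YS)
  have "compact ((\<lambda>v. Y (Suc 0) v) ` {0..1})"
    by (intro compact_continuous_image cont) auto
  then obtain C where C: "C > 0" "\<And>v. v \<in> {0..1} \<Longrightarrow> \<bar>Y (Suc 0) v\<bar> \<le> C"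
    using bounded_pos[of "Y (Suc 0) ` {0..1}"] compact_imp_bounded by (auto simp: image_iff)
  \<comment> \<open>The weight \<open>exp (2 * L * (1 - v))\<close> turns each Picard step into a contraction by one half.\<close>
  have step: "\<bar>Y (Suc n) v - Y n v\<bar> \<le> C * (1/2) ^ n * exp (2 * L * (1 - v))" if "v \<in> {0..1}" for n v
    using that
  proof (induction n arbitrary: v)
    case 0
    have "C * 1 \<le> C * exp (2 * L * (1 - v))"
      using C L 0 by (intro mult_left_mono) auto
    then show ?case using C(2)[OF 0] by (simp add: Y0)
  next
    case (Suc n)
    define E where "E = (\<lambda>v. C * (1/2) ^ Suc n * exp (2 * L * (1 - v)))"
    have E: "(E has_real_derivative - (L * (C * (1/2) ^ n * exp (2 * L * (1 - v))))) (at v)" for v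
      unfolding E_def by (auto intro!: derivative_eq_intros)
    have contE: "continuous_on {v..1} E"
      unfolding E_def by (intro continuous_intros)
    have contD: "continuous_on {v..1} (Y n)" for n
      by (rule continuous_on_subset[OF cont]) (use Suc.prems in auto)
    have *: "\<bar>(h (Y (Suc n) x) - f x) - (h (Y n x) - f x)\<bar> \<le> L * (C * (1/2) ^ n * exp (2 * L * (1 - x)))"
      if "v < x" "x < 1" for x
    proof -
      have "L * \<bar>Y (Suc n) x - Y n x\<bar> \<le> L * (C * (1/2) ^ n * exp (2 * L * (1 - x)))"
        using that L Suc.prems by (intro mult_left_mono Suc.IH) auto
      then show ?thesis using lip[of "Y (Suc n) x" "Y n x"] by simp
    qed
    have E1: "E 1 \<ge> 0" using C by (simp add: E_def)
    have "E 1 - (Y (Suc (Suc n)) 1 - Y (Suc n) 1) \<le> E v - (Y (Suc (Suc n)) v - Y (Suc n) v)"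
    proof (rule DERIV_nonpos_imp_decreasing_open[where f = "\<lambda>v. E v - (Y (Suc (Suc n)) v - Y (Suc n) v)"])
      show "v \<le> 1" using Suc.prems by simp
      fix x assume x: "v < x" "x < 1"
      show "\<exists>d. ((\<lambda>v. E v - (Y (Suc (Suc n)) v - Y (Suc n) v)) has_real_derivative d) (at x) \<and> d \<le> 0"
        using x Suc.prems *[OF x]
        by - (intro exI conjI, rule DERIV_diff[OF E DERIV_diff[OF deriv' deriv']], auto)
    qed (intro continuous_intros contE contD)
    moreover have "E 1 + (Y (Suc (Suc n)) 1 - Y (Suc n) 1) \<le> E v + (Y (Suc (Suc n)) v - Y (Suc n) v)"
    proof (rule DERIV_nonpos_imp_decreasing_open[where f = "\<lambda>v. E v + (Y (Suc (Suc n)) v - Y (Suc n) v)"])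
      show "v \<le> 1" using Suc.prems by simp
      fix x assume x: "v < x" "x < 1"
      show "\<exists>d. ((\<lambda>v. E v + (Y (Suc (Suc n)) v - Y (Suc n) v)) has_real_derivative d) (at x) \<and> d \<le> 0"
        using x Suc.prems *[OF x]
        by - (intro exI conjI, rule DERIV_add[OF E DERIV_diff[OF deriv' deriv']], auto)
    qed (intro continuous_intros contE contD)
    ultimately have "\<bar>Y (Suc (Suc n)) v - Y (Suc n) v\<bar> \<le> E v"
      using E1 Y1 by simp
    then show ?case by (simp add: E_def)
  qed
  have "uniform_limit {0..1} (\<lambda>n v. \<Sum>i<n. Y (Suc i) v - Y i v) (\<lambda>v. \<Sum>i. Y (Suc i) v - Y i v) sequentially"
  proof (rule Weierstrass_m_test)
    show "norm (Y (Suc n) v - Y n v) \<le> C * exp (2 * L) * (1/2) ^ n" if v: "v \<in> {0..1}" for n v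
    proof -
      have "exp (2 * L * (1 - v)) \<le> exp (2 * L)"
        using v L by simp
      then have "C * (1/2) ^ n * exp (2 * L * (1 - v)) \<le> C * (1/2) ^ n * exp (2 * L)"
        using C by (intro mult_left_mono) auto
      then show ?thesis using step[OF v, of n] by (simp add: mult_ac)
    qed
    show "summable (\<lambda>n. C * exp (2 * L) * (1/2) ^ n)"
      by (intro summable_mult summable_geometric) auto
  qed
  moreover have "(\<Sum>i<n. Y (Suc i) v - Y i v) = Y n v" for n v
    using sum_lessThan_telescope[of "\<lambda>i. Y i v" n] by (simp add: Y0)
  ultimately obtain y where y: "uniform_limit {0..1} Y y sequentially"
    by auto
  have hy: "uniform_limit {0..1} (\<lambda>n v. h (Y n v) - f v) (\<lambda>v. h (y v) - f v) sequentially"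
  proof (rule uniform_limitI)
    fix e :: real assume "e > 0"
    then have "\<forall>\<^sub>F n in sequentially. \<forall>v\<in>{0..1}. dist (Y n v) (y v) < e / L"
      using L by (intro uniform_limitD[OF y]) simp
    then show "\<forall>\<^sub>F n in sequentially. \<forall>v\<in>{0..1}. dist (h (Y n v) - f v) (h (y v) - f v) < e"
    proof eventually_elim
      case (elim n)
      show ?case
      proof
        fix v :: real assume "v \<in> {0..1}"
        then have "L * \<bar>Y n v - y v\<bar> < e"
          using elim L by (auto simp: dist_real_def field_simps)
        then show "dist (h (Y n v) - f v) (h (y v) - f v) < e"
          using lip[of "Y n v" "y v"] by (auto simp: dist_real_def)
      qed
    qed
  qed
  have yS: "uniform_limit {0..1} (\<lambda>n. Y (Suc n)) y sequentially"
    using y by (simp add: filterlim_sequentially_Suc)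
  have "(\<lambda>n. Y n 1) \<longlonglongrightarrow> y 1"
    by (rule tendsto_uniform_limitI[OF y]) simp
  then have "y 1 = 0"
    by (simp add: Y1 LIMSEQ_const_iff)
  then show ?thesis
    using has_real_derivative_uniform_limit[OF deriv yS hy] by blast
qed

text \<open>For nondecreasing \<open>g\<close>, Lipschitz continuity can be weakened to uniform approximability by
  Lipschitz functions \<open>h\<close>; these need not be monotone themselves.\<close>

lemma monotone_terminal_value_problem:
  fixes f g :: "real \<Rightarrow> real"
  assumes f: "continuous_on {0..1} f" and g: "mono g"
    and approx: "\<And>e. e > 0 \<Longrightarrow>
      \<exists>L h. L > 0 \<and> (\<forall>x y. \<bar>h x - h y\<bar> \<le> L * \<bar>x - y\<bar>) \<and> (\<forall>x. \<bar>h x - g x\<bar> \<le> e)"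
  shows "\<exists>y. y 1 = 0 \<and> (\<forall>v\<in>{0..1}. (y has_real_derivative g (y v) - f v) (at v within {0..1}))"
proof -
  define e where "e n = inverse (real (Suc n))" for n
  have e: "e n > 0" for n by (simp add: e_def)
  have e0: "e \<longlonglongrightarrow> 0"
    unfolding e_def by (rule LIMSEQ_inverse_real_of_nat)
  have "\<forall>n. \<exists>h y. (\<forall>x. \<bar>h x - g x\<bar> \<le> e n) \<and> y 1 = 0 \<and>
      (\<forall>v\<in>{0..1}. (y has_real_derivative h (y v) - f v) (at v within {0..1}))"
    using approx[OF e] lipschitz_terminal_value_problem[OF f] by meson
  then obtain H where "\<forall>n. \<exists>y. (\<forall>x. \<bar>H n x - g x\<bar> \<le> e n) \<and> y 1 = 0 \<and>
      (\<forall>v\<in>{0..1}. (y has_real_derivative H n (y v) - f v) (at v within {0..1}))"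
    using choice[of "\<lambda>n h. \<exists>y. (\<forall>x. \<bar>h x - g x\<bar> \<le> e n) \<and> y 1 = 0 \<and>
      (\<forall>v\<in>{0..1}. (y has_real_derivative h (y v) - f v) (at v within {0..1}))"] by auto
  then obtain Y where "\<forall>n. (\<forall>x. \<bar>H n x - g x\<bar> \<le> e n) \<and> Y n 1 = 0 \<and>
      (\<forall>v\<in>{0..1}. (Y n has_real_derivative H n (Y n v) - f v) (at v within {0..1}))"
    using choice[of "\<lambda>n y. (\<forall>x. \<bar>H n x - g x\<bar> \<le> e n) \<and> y 1 = 0 \<and>
      (\<forall>v\<in>{0..1}. (y has_real_derivative H n (y v) - f v) (at v within {0..1}))"] by auto
  then have H: "\<And>n x. \<bar>H n x - g x\<bar> \<le> e n" and Y1: "\<And>n. Y n 1 = 0"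
    and deriv: "\<And>n v. v \<in> {0..1} \<Longrightarrow> (Y n has_real_derivative H n (Y n v) - f v) (at v within {0..1})"
    by blast+
  have cont: "continuous_on {0..1} (Y n)" for n
    by (rule DERIV_continuous_on[OF deriv])
  \<comment> \<open>Monotonicity of \<open>g\<close> makes the backward flow contractive, so only the errors accumulate.\<close>
  have diff: "Y n v - Y m v \<le> e n + e m" if v: "v \<in> {0..1}" for n m v
  proof (rule ccontr)
    assume neg: "\<not> Y n v - Y m v \<le> e n + e m"
    define D where "D x = Y n x - Y m x - (e n + e m) * (1 - x)" for x
    have emp: "(e n + e m) * (1 - x) \<ge> 0" if "x \<le> 1" for x
      using e[of n] e[of m] that by simp
    have "D v \<le> D 1"
    proof (rule le_of_deriv_nonneg_where_positive[where D = D])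
      show "v \<le> 1" using v by simp
      show "continuous_on {v..1} D"
        unfolding D_def using v
        by (intro continuous_intros continuous_on_subset[OF cont]) auto
      show "D v > 0"
      proof -
        have "(e n + e m) * (1 - v) \<le> (e n + e m) * 1"
          using e[of n] e[of m] v by (intro mult_left_mono) auto
        then show ?thesis using neg by (simp add: D_def)
      qed
      fix x assume x: "v < x" "x < 1" "D x > 0"
      have "Y m x \<le> Y n x"
        using x emp[of x] by (simp add: D_def)
      then have "g (Y m x) \<le> g (Y n x)" using g by (simp add: mono_def)
      then have "H n (Y n x) - H m (Y m x) + (e n + e m) \<ge> 0"
        using H[of n "Y n x"] H[of m "Y m x"] by linarith
      moreover have "(D has_real_derivative H n (Y n x) - H m (Y m x) + (e n + e m)) (at x)"
        unfolding D_def
        using deriv[of x n] deriv[of x m] x v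
        by (auto intro!: derivative_eq_intros simp: at_within_Icc_at)
      ultimately show "\<exists>d\<ge>0. (D has_real_derivative d) (at x)" by blast
    qed
    moreover have "D 1 = 0" by (simp add: D_def Y1)
    moreover have "(e n + e m) * (1 - v) \<le> (e n + e m) * 1"
      using e[of n] e[of m] v by (intro mult_left_mono) auto
    ultimately show False using neg by (simp add: D_def)
  qed
  have "uniformly_Cauchy_on {0..1} Y"
  proof (rule uniformly_Cauchy_onI)
    fix d :: real assume d: "d > 0"
    obtain N where N: "\<And>n. n \<ge> N \<Longrightarrow> e n < d / 2"
      using order_tendstoD(2)[OF e0, of "d / 2"] d by (auto simp: eventually_sequentially)
    show "\<exists>N. \<forall>x\<in>{0..1}. \<forall>m\<ge>N. \<forall>n\<ge>N. dist (Y m x) (Y n x) < d"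
    proof (intro exI[of _ N] ballI allI impI)
      fix x :: real and m n assume "x \<in> {0..1}" "m \<ge> N" "n \<ge> N"
      then show "dist (Y m x) (Y n x) < d"
        using diff[of x m n] diff[of x n m] N[of m] N[of n] unfolding dist_real_def by linarith
    qed
  qed
  then obtain y where y: "uniform_limit {0..1} Y y sequentially"
    using Cauchy_uniformly_convergent uniformly_convergent_on_def by blast
  have hy: "uniform_limit {0..1} (\<lambda>n v. H n (Y n v) - f v) (\<lambda>v. g (y v) - f v) sequentially"
  proof (rule uniform_limitI)
    fix d :: real assume d: "d > 0"
    obtain L h where L: "L > 0" "\<And>x y. \<bar>h x - h y\<bar> \<le> L * \<bar>x - y\<bar>" and h: "\<And>x. \<bar>h x - g x\<bar> \<le> d / 4"
      using approx[of "d / 4"] d by auto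
    have "\<forall>\<^sub>F n in sequentially. \<forall>v\<in>{0..1}. dist (Y n v) (y v) < d / 4 / L"
      using L d by (intro uniform_limitD[OF y]) simp
    moreover have "\<forall>\<^sub>F n in sequentially. e n < d / 4"
      using order_tendstoD(2)[OF e0, of "d / 4"] d by simp
    ultimately show "\<forall>\<^sub>F n in sequentially. \<forall>v\<in>{0..1}. dist (H n (Y n v) - f v) (g (y v) - f v) < d"
    proof eventually_elim
      case (elim n)
      show ?case
      proof
        fix v :: real assume "v \<in> {0..1}"
        then have "L * \<bar>Y n v - y v\<bar> < d / 4"
          using elim L by (auto simp: dist_real_def field_simps)
        then show "dist (H n (Y n v) - f v) (g (y v) - f v) < d"
          using L(2)[of "Y n v" "y v"] h[of "Y n v"] h[of "y v"] H[of n "Y n v"] elim(2)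
          unfolding dist_real_def by linarith
      qed
    qed
  qed
  have "(\<lambda>n. Y n 1) \<longlonglongrightarrow> y 1"
    by (rule tendsto_uniform_limitI[OF y]) simp
  then have "y 1 = 0"
    by (simp add: Y1 LIMSEQ_const_iff)
  then show ?thesis
    using has_real_derivative_uniform_limit[OF deriv y hy] by blast
qed


section \<open>The nonlinearity and its rectifying coordinate\<close>

locale reaction_bvp =
  fixes a b :: real and f :: "real \<Rightarrow> real"
  assumes a: "a > 0" and b: "b > 0" and cont_f: "continuous_on {0..1} f"
begin

abbreviation R :: "real \<Rightarrow> real" where
  "R \<equiv> Rfun a b"

text \<open>The primitive of \<open>1 / (a * R)\<close> on \<open>[0,\<infinity>)\<close> that vanishes at \<open>0\<close> (see \<open>rect_deriv\<close>). Only its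
  values at nonnegative arguments are meaningful.\<close>

definition rect :: "real \<Rightarrow> real" where
  "rect y = sqrt (y * (2 * a + b\<^sup>2 * y)) / a"

lemma den_pos: "y \<ge> 0 \<Longrightarrow> a + b\<^sup>2 * y > 0"
  using a by (simp add: add_pos_nonneg)

lemma R_0 [simp]: "R 0 = 0"
  by (simp add: Rfun_def)

lemma R_pos: "y > 0 \<Longrightarrow> R y > 0"
  using a b den_pos[of y] by (auto simp: Rfun_def intro!: divide_pos_pos mult_pos_pos add_pos_nonneg)

lemma R_nonneg: "y \<ge> 0 \<Longrightarrow> R y \<ge> 0"
  using R_pos[of y] by (cases "y = 0") auto

text \<open>Unlike \<open>R\<close> itself, its square is Lipschitz up to \<open>0\<close>, and visibly monotone.\<close>

lemma R_power2: "y \<ge> 0 \<Longrightarrow> (R y)\<^sup>2 = (1 - (a / (a + b\<^sup>2 * y))\<^sup>2) / b\<^sup>2"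
proof -
  assume y: "y \<ge> 0"
  define d where "d = a + b\<^sup>2 * y"
  have d: "d > 0" using den_pos[OF y] by (simp add: d_def)
  have "b\<^sup>2 * (y * (2 * a + b\<^sup>2 * y)) = d\<^sup>2 - a\<^sup>2"
    by (simp add: d_def power2_eq_square algebra_simps)
  then have "y * (2 * a + b\<^sup>2 * y) = (d\<^sup>2 - a\<^sup>2) / b\<^sup>2"
    using b by (simp add: field_simps)
  moreover have "(R y)\<^sup>2 = y * (2 * a + b\<^sup>2 * y) / d\<^sup>2"
    using y a by (simp add: Rfun_def d_def power_divide)
  ultimately have "(R y)\<^sup>2 = ((d\<^sup>2 - a\<^sup>2) / b\<^sup>2) / d\<^sup>2"
    by simp
  also have "\<dots> = (1 - (a / d)\<^sup>2) / b\<^sup>2"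
    using b d by (simp add: field_simps power_divide)
  finally show ?thesis by (simp add: d_def)
qed

lemma R_mono:
  assumes "0 \<le> x" "x \<le> y"
  shows "R x \<le> R y"
proof -
  have "a / (a + b\<^sup>2 * y) \<le> a / (a + b\<^sup>2 * x)"
    using assms a den_pos[of x] den_pos[of y]
    by (intro divide_left_mono mult_pos_pos add_left_mono mult_left_mono) auto
  then have "(a / (a + b\<^sup>2 * y))\<^sup>2 \<le> (a / (a + b\<^sup>2 * x))\<^sup>2"
    using a den_pos[of y] assms by (intro power_mono) (auto intro!: divide_nonneg_nonneg)
  then have "(R x)\<^sup>2 \<le> (R y)\<^sup>2"
    using assms by (simp add: R_power2 divide_right_mono)
  then show ?thesis
    using R_nonneg assms by (meson order_trans power2_le_imp_le)
qed

lemma R_le: "y \<ge> 0 \<Longrightarrow> R y \<le> 1 / b"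
proof (rule power2_le_imp_le)
  show "(R y)\<^sup>2 \<le> (1 / b)\<^sup>2" if "y \<ge> 0"
    using that by (simp add: R_power2 power_divide divide_right_mono)
qed (use b in auto)

lemma R_power2_diff_le:
  assumes "0 \<le> x" "x \<le> y"
  shows "(R y)\<^sup>2 - (R x)\<^sup>2 \<le> 2 * (y - x) / a"
proof -
  define u where "u z = a / (a + b\<^sup>2 * z)" for z
  have u: "0 \<le> u z" "u z \<le> 1" if "z \<ge> 0" for z
    using that a den_pos[of z] by (auto simp: u_def)
  have "u x - u y = a * b\<^sup>2 * (y - x) / ((a + b\<^sup>2 * x) * (a + b\<^sup>2 * y))"
    using den_pos[of x] den_pos[of y] assms by (simp add: u_def diff_frac_eq algebra_simps)
  also have "\<dots> \<le> a * b\<^sup>2 * (y - x) / (a * a)"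
    using assms a by (intro divide_left_mono mult_mono) (auto intro!: mult_pos_pos add_pos_nonneg)
  finally have diff: "u x - u y \<le> b\<^sup>2 * (y - x) / a"
    using a by simp
  have "(R y)\<^sup>2 - (R x)\<^sup>2 = ((u x)\<^sup>2 - (u y)\<^sup>2) / b\<^sup>2"
    using assms by (simp add: R_power2 u_def[symmetric] diff_divide_distrib)
  also have "(u x)\<^sup>2 - (u y)\<^sup>2 = (u x - u y) * (u x + u y)"
    by (simp add: power2_eq_square algebra_simps)
  also have "\<dots> \<le> (b\<^sup>2 * (y - x) / a) * 2"
    using diff u[of x] u[of y] assms a by (intro mult_mono) auto
  also have "\<dots> / b\<^sup>2 = 2 * (y - x) / a"
    using b by simp
  finally show ?thesis
    by (simp add: divide_right_mono)
qed

lemma R_diff_le: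
  assumes "0 < d" "d \<le> x" "x \<le> y"
  shows "R y - R x \<le> (y - x) / (a * R d)"
proof -
  have pos: "R d > 0" and le: "R d \<le> R x" "R x \<le> R y"
    using assms by (auto intro: R_pos R_mono)
  have "(R y - R x) * (2 * R d) \<le> (R y - R x) * (R y + R x)"
    using le by (intro mult_left_mono) auto
  also have "\<dots> = (R y)\<^sup>2 - (R x)\<^sup>2"
    by (simp add: power2_eq_square algebra_simps)
  also have "\<dots> \<le> 2 * (y - x) / a"
    using assms by (intro R_power2_diff_le) auto
  finally show ?thesis using pos a by (simp add: field_simps)
qed

lemma rect_0 [simp]: "rect 0 = 0"
  by (simp add: rect_def)

lemma rect_less:
  assumes "0 \<le> x" "x < y"
  shows "rect x < rect y"
proof -
  have "x * (2 * a + b\<^sup>2 * x) \<le> x * (2 * a + b\<^sup>2 * y)"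
    using assms by (intro mult_left_mono add_left_mono) auto
  also have "\<dots> < y * (2 * a + b\<^sup>2 * y)"
    using assms a by (intro mult_strict_right_mono add_pos_nonneg) auto
  finally show ?thesis
    using a by (simp add: rect_def divide_strict_right_mono)
qed

lemma rect_le: "0 \<le> x \<Longrightarrow> x \<le> y \<Longrightarrow> rect x \<le> rect y"
  using rect_less[of x y] by (cases "x = y") auto

lemma rect_power2:
  assumes "y \<ge> 0"
  shows "(rect y)\<^sup>2 = b\<^sup>2 / a\<^sup>2 * y\<^sup>2 + 2 / a * y"
proof -
  have "y * (2 * a + b\<^sup>2 * y) \<ge> 0"
    using assms a by simp
  then have "(rect y)\<^sup>2 = y * (2 * a + b\<^sup>2 * y) / a\<^sup>2"
    by (simp add: rect_def power_divide)
  then show ?thesis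
    using a by (simp add: power2_eq_square field_simps)
qed

lemma continuous_rect: "continuous_on S rect"
  unfolding rect_def using a by (intro continuous_intros) auto

lemma rect_deriv:
  assumes "y > 0"
  shows "(rect has_real_derivative 1 / (a * R y)) (at y)"
proof -
  have "y * (2 * a + b\<^sup>2 * y) > 0"
    using assms a by (intro mult_pos_pos add_pos_nonneg) auto
  then have "(rect has_real_derivative
      inverse (sqrt (y * (2 * a + b\<^sup>2 * y))) / 2 * ((2 * a + b\<^sup>2 * y) + b\<^sup>2 * y) / a) (at y)"
    unfolding rect_def using a by (auto intro!: derivative_eq_intros simp: field_simps)
  moreover have "inverse s / 2 * (2 * u) / a = 1 / (a * (s / u))" for s u :: real
    by (simp add: divide_simps)
  from this[of "sqrt (y * (2 * a + b\<^sup>2 * y))" "a + b\<^sup>2 * y"]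
  have "inverse (sqrt (y * (2 * a + b\<^sup>2 * y))) / 2 * ((2 * a + b\<^sup>2 * y) + b\<^sup>2 * y) / a = 1 / (a * R y)"
    by (simp only: Rfun_def distrib_left mult_2 add_ac)
  ultimately show ?thesis by simp
qed

lemma inverse_R_le:
  assumes "y > 0"
  shows "1 / R y \<le> 1 / rect y + b"
proof -
  define s where "s = sqrt (y * (2 * a + b\<^sup>2 * y))"
  have s: "s > 0"
    unfolding s_def using assms a by (auto intro!: mult_pos_pos add_pos_nonneg)
  have "b * y \<le> s"
    unfolding s_def using assms a
    by (intro real_le_rsqrt) (simp add: power2_eq_square algebra_simps)
  then have "b * (b * y) \<le> b * s"
    using b by (intro mult_left_mono) auto
  then have "(a + b\<^sup>2 * y) / s \<le> (a + b * s) / s"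
    using s by (intro divide_right_mono) (auto simp: power2_eq_square mult.assoc)
  then show ?thesis
    using s unfolding Rfun_def rect_def s_def[symmetric] by (simp add: add_divide_distrib)
qed

section \<open>The decreasing family of terminal value solutions\<close>

text \<open>Backward solutions from \<open>y 1 = 0\<close>. They may become negative; there the nonlinearity is
  continued by its value \<open>R 0 = 0\<close>, which keeps it continuous and nondecreasing.\<close>

definition terminal_solution :: "real \<Rightarrow> (real \<Rightarrow> real) \<Rightarrow> bool" where
  "terminal_solution c y \<longleftrightarrow> y 1 = 0 \<and>
    (\<forall>v\<in>{0..1}. (y has_real_derivative c * a * R (max 0 (y v)) - f v) (at v within {0..1}))"

lemma terminal_solution_exists:
  assumes c: "c \<ge> 0"
  shows "\<exists>y. terminal_solution c y"
  unfolding terminal_solution_def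
proof (rule monotone_terminal_value_problem[OF cont_f, of "\<lambda>y. c * a * R (max 0 y)"])
  show "mono (\<lambda>y. c * a * R (max 0 y))"
    using c a by (intro monoI mult_left_mono R_mono) auto
  fix e :: real assume e: "e > 0"
  \<comment> \<open>Freezing \<open>R\<close> below \<open>d\<close> makes it Lipschitz, at the cost of an error of at most \<open>R d\<close>;
    the choice of \<open>d\<close> gives \<open>R d \<le> r\<close>.\<close>
  define r where "r = e / (c * a + 1)"
  define d where "d = a * r\<^sup>2 / 2"
  have ca: "c * a \<ge> 0" using c a by simp
  have r: "r > 0" using ca e by (simp add: r_def)
  have d: "d > 0" using r a by (simp add: d_def)
  have Rd: "R d > 0" using R_pos[OF d] .
  have "(R d)\<^sup>2 \<le> r\<^sup>2"
    using R_power2_diff_le[of 0 d] d a by (simp add: d_def)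
  then have "R d \<le> r" using r by (auto dest: power2_le_imp_le)
  then have "c * a * R d \<le> c * a * r" using ca by (intro mult_left_mono) auto
  also have "\<dots> \<le> (c * a + 1) * r" using r by (simp add: distrib_right)
  also have "\<dots> = e" using ca by (simp add: r_def)
  finally have caR: "c * a * R d \<le> e" .
  define L where "L = c * a / (a * R d) + 1"
  have L: "L > 0" using c Rd a by (simp add: L_def add_nonneg_pos)
  have lip: "\<bar>c * a * R (max d x) - c * a * R (max d y)\<bar> \<le> L * \<bar>x - y\<bar>" for x y
  proof -
    have *: "\<bar>c * a * R (max d x) - c * a * R (max d y)\<bar> \<le> L * \<bar>x - y\<bar>" if "y \<le> x" for x y
    proof -
      have le: "R (max d y) \<le> R (max d x)" using d that by (intro R_mono) auto
      have "R (max d x) - R (max d y) \<le> (max d x - max d y) / (a * R d)"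
        using d that by (intro R_diff_le) auto
      also have "\<dots> \<le> (x - y) / (a * R d)"
        using that a Rd by (intro divide_right_mono) auto
      finally have "c * a * (R (max d x) - R (max d y)) \<le> c * a * ((x - y) / (a * R d))"
        using ca by (intro mult_left_mono) auto
      also have "\<dots> \<le> L * (x - y)"
        using that by (simp add: L_def distrib_right)
      finally show ?thesis
        using le that mult_left_mono[OF le ca] by (simp add: right_diff_distrib)
    qed
    show ?thesis
      using *[of x y] *[of y x] by (cases "y \<le> x") (auto simp: abs_minus_commute)
  qed
  have "\<bar>c * a * R (max d x) - c * a * R (max 0 x)\<bar> \<le> e" for x
  proof (cases "d \<le> x")
    case True
    then show ?thesis using d e by (simp add: max_def)
  next
    case False
    have "0 \<le> R (max 0 x)" "R (max 0 x) \<le> R d"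
      using d False by (auto intro!: R_nonneg R_mono)
    then have "0 \<le> c * a * R (max 0 x)" "c * a * R (max 0 x) \<le> c * a * R d"
      using ca by (auto intro!: mult_nonneg_nonneg[of "c * a"] mult_left_mono)
    moreover have "max d x = d" using False by simp
    ultimately show ?thesis using caR by simp
  qed
  then show "\<exists>L h. L > 0 \<and> (\<forall>x y. \<bar>h x - h y\<bar> \<le> L * \<bar>x - y\<bar>) \<and> (\<forall>x. \<bar>h x - c * a * R (max 0 x)\<bar> \<le> e)"
    using L lip by (intro exI[of _ L] exI[of _ "\<lambda>y. c * a * R (max d y)"]) auto
qed

lemma terminal_solution_deriv:
  assumes "terminal_solution c y" "0 < v" "v < 1"
  shows "(y has_real_derivative c * a * R (max 0 (y v)) - f v) (at v)"
  using assms by (auto simp: terminal_solution_def at_within_Icc_at dest: bspec[of _ _ v])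

lemma terminal_solution_continuous:
  assumes "terminal_solution c y" "S \<subseteq> {0..1}"
  shows "continuous_on S y"
proof (rule continuous_on_subset[OF _ assms(2)])
  show "continuous_on {0..1} y"
    by (rule DERIV_continuous_on[where D = "\<lambda>v. c * a * R (max 0 (y v)) - f v"])
      (use assms(1) in \<open>simp add: terminal_solution_def\<close>)
qed

lemma terminal_solution_antimono:
  assumes cc: "0 \<le> c" "c \<le> c'"
    and y: "terminal_solution c y" and y': "terminal_solution c' y'" and v: "v \<in> {0..1}"
  shows "y' v \<le> y v"
proof (rule ccontr)
  assume neg: "\<not> y' v \<le> y v"
  define D where "D x = y' x - y x" for x
  have "D v \<le> D 1"
  proof (rule le_of_deriv_nonneg_where_positive[where D = D])
    show "v \<le> 1" using v by simp
    show "continuous_on {v..1} D"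
      unfolding D_def using v
      by (intro continuous_intros terminal_solution_continuous[OF y] terminal_solution_continuous[OF y']) auto
    show "D v > 0" using neg by (simp add: D_def)
    fix x assume x: "v < x" "x < 1" "D x > 0"
    have "c * a * R (max 0 (y x)) \<le> c' * a * R (max 0 (y' x))"
      using x cc a by (intro mult_mono R_mono) (auto simp: D_def R_nonneg)
    moreover have "(D has_real_derivative (c' * a * R (max 0 (y' x)) - f x) - (c * a * R (max 0 (y x)) - f x)) (at x)"
      unfolding D_def using x v
      by (intro DERIV_diff terminal_solution_deriv[OF y] terminal_solution_deriv[OF y']) auto
    ultimately show "\<exists>d\<ge>0. (D has_real_derivative d) (at x)"
      by (intro exI conjI) auto
  qed
  then show False
    using neg y y' by (simp add: D_def terminal_solution_def)
qed

lemma terminal_solution_lipschitz: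
  assumes cc: "0 \<le> c" "c \<le> c'"
    and y: "terminal_solution c y" and y': "terminal_solution c' y'" and v: "v \<in> {0..1}"
  shows "y v \<le> y' v + (c' - c) * (a / b)"
proof (rule ccontr)
  assume neg: "\<not> y v \<le> y' v + (c' - c) * (a / b)"
  define K where "K = (c' - c) * (a / b)"
  have K: "K \<ge> 0" using cc a b by (simp add: K_def)
  define D where "D x = y x - y' x - K * (1 - x)" for x
  have Kv: "K * (1 - v) \<le> K * 1" using K v by (intro mult_left_mono) auto
  have "D v \<le> D 1"
  proof (rule le_of_deriv_nonneg_where_positive[where D = D])
    show "v \<le> 1" using v by simp
    show "continuous_on {v..1} D"
      unfolding D_def using v
      by (intro continuous_intros terminal_solution_continuous[OF y] terminal_solution_continuous[OF y']) auto
    show "D v > 0" using neg Kv unfolding D_def K_def[symmetric] by linarith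
    fix x assume x: "v < x" "x < 1" "D x > 0"
    have "K * (1 - x) \<ge> 0" using K x by simp
    then have "y' x \<le> y x" using x by (simp add: D_def)
    then have "c * a * R (max 0 (y' x)) \<le> c * a * R (max 0 (y x))"
      using cc a by (intro mult_left_mono R_mono) auto
    moreover have "((c' - c) * a) * R (max 0 (y' x)) \<le> ((c' - c) * a) * (1 / b)"
      using cc a by (intro mult_left_mono R_le) auto
    ultimately have "(c * a * R (max 0 (y x)) - f x) - (c' * a * R (max 0 (y' x)) - f x) + K \<ge> 0"
      by (simp add: K_def algebra_simps diff_divide_distrib)
    moreover have "(D has_real_derivative (c * a * R (max 0 (y x)) - f x) - (c' * a * R (max 0 (y' x)) - f x) + K) (at x)"
      unfolding D_def using x v
      by (auto intro!: derivative_eq_intros terminal_solution_deriv[OF y] terminal_solution_deriv[OF y'])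
    ultimately show "\<exists>d\<ge>0. (D has_real_derivative d) (at x)" by blast
  qed
  then show False
    using neg y y' Kv unfolding D_def terminal_solution_def K_def[symmetric] by simp
qed

text \<open>The terminal solution of speed \<open>c\<close>, which for \<open>c \<ge> 0\<close> exists and is unique on \<open>[0,1]\<close>.
  For \<open>c < 0\<close> the value is arbitrary, and it is never used.\<close>

definition flow :: "real \<Rightarrow> real \<Rightarrow> real" where
  "flow c = (SOME y. terminal_solution c y)"

lemma flow: "c \<ge> 0 \<Longrightarrow> terminal_solution c (flow c)"
  unfolding flow_def using terminal_solution_exists by (rule someI_ex)

lemma terminal_solution_eq_flow:
  assumes "c \<ge> 0" "terminal_solution c y" "v \<in> {0..1}"
  shows "y v = flow c v"
proof (rule order_antisym)
  show "y v \<le> flow c v"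
    by (rule terminal_solution_antimono[OF assms(1) order_refl flow[OF assms(1)] assms(2,3)])
  show "flow c v \<le> y v"
    by (rule terminal_solution_antimono[OF assms(1) order_refl assms(2) flow[OF assms(1)] assms(3)])
qed

lemma flow_antimono:
  assumes "0 \<le> c" "c \<le> c'" "v \<in> {0..1}"
  shows "flow c' v \<le> flow c v"
  by (rule terminal_solution_antimono[OF assms(1,2) flow flow assms(3)]) (use assms in linarith)+

lemma flow_1: "c \<ge> 0 \<Longrightarrow> flow c 1 = 0"
  using flow by (simp add: terminal_solution_def)

lemma continuous_flow_in_speed:
  assumes v: "v \<in> {0..1}"
  shows "continuous_on {0..} (\<lambda>c. flow c v)"
proof (rule lipschitz_on_continuous_on)
  show "(a / b)-lipschitz_on {0..} (\<lambda>c. flow c v)"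
  proof (rule lipschitz_onI)
    have *: "\<bar>flow c v - flow c' v\<bar> \<le> a / b * \<bar>c - c'\<bar>" if "0 \<le> c" "c \<le> c'" for c c'
      using flow_antimono[OF that v] terminal_solution_lipschitz[OF that flow flow v] that
      by (simp add: mult.commute)
    show "dist (flow c v) (flow c' v) \<le> a / b * dist c c'" if "c \<in> {0..}" "c' \<in> {0..}" for c c'
      using *[of c c'] *[of c' c] that by (cases "c \<le> c'") (auto simp: dist_real_def abs_minus_commute)
    show "a / b \<ge> 0" using a b by simp
  qed
qed

lemma flow_deriv:
  "c \<ge> 0 \<Longrightarrow> 0 < v \<Longrightarrow> v < 1 \<Longrightarrow> (flow c has_real_derivative c * a * R (max 0 (flow c v)) - f v) (at v)"
  using terminal_solution_deriv[OF flow] .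

lemma continuous_flow: "c \<ge> 0 \<Longrightarrow> S \<subseteq> {0..1} \<Longrightarrow> continuous_on S (flow c)"
  using terminal_solution_continuous[OF flow] .

abbreviation F :: "real \<Rightarrow> real" where
  "F \<equiv> primF f"

lemma primF_0: "F 0 = 0"
  by (simp add: primF_def)

lemma primF_deriv_within:
  assumes "v \<in> {0..1}"
  shows "(F has_real_derivative f v) (at v within {0..1})"
proof -
  have "F = (\<lambda>x. integral {0..x} f)"
    by (rule ext) (rule primF_def)
  then show ?thesis
    using integral_has_real_derivative[OF cont_f assms] by simp
qed

lemma primF_deriv:
  assumes "0 < v" "v < 1"
  shows "(F has_real_derivative f v) (at v)"
  using primF_deriv_within[of v] assms by (simp add: at_within_Icc_at)

lemma continuous_primF: "S \<subseteq> {0..1} \<Longrightarrow> continuous_on S F"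
  by (rule continuous_on_subset[OF DERIV_continuous_on[OF primF_deriv_within]])

lemma primF_less:
  assumes "0 \<le> s" "s < t" "t \<le> 1" "\<And>x. s < x \<Longrightarrow> x < t \<Longrightarrow> f x > 0"
  shows "F s < F t"
proof (rule DERIV_pos_imp_increasing_open[OF assms(2)])
  show "continuous_on {s..t} F" by (rule continuous_primF) (use assms in auto)
  show "\<exists>d. (F has_real_derivative d) (at x) \<and> 0 < d" if "s < x" "x < t" for x
    using primF_deriv[of x] assms that by auto
qed

lemma flow_plus_primF_mono:
  assumes c: "c \<ge> 0" and st: "0 \<le> s" "s \<le> t" "t \<le> 1"
  shows "flow c s + F s \<le> flow c t + F t"
proof (rule DERIV_nonneg_imp_increasing_open[where f = "\<lambda>x. flow c x + F x", OF st(2)])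
  show "continuous_on {s..t} (\<lambda>x. flow c x + F x)"
    using st by (intro continuous_intros continuous_flow c continuous_primF) auto
  fix x assume x: "s < x" "x < t"
  have "((\<lambda>x. flow c x + F x) has_real_derivative c * a * R (max 0 (flow c x)) - f x + f x) (at x)"
    using x st by (intro DERIV_add flow_deriv c primF_deriv) auto
  moreover have "c * a * R (max 0 (flow c x)) \<ge> 0"
    using c a by (intro mult_nonneg_nonneg R_nonneg) auto
  ultimately show "\<exists>d. ((\<lambda>x. flow c x + F x) has_real_derivative d) (at x) \<and> 0 \<le> d"
    by auto
qed

lemma flow_0: "v \<in> {0..1} \<Longrightarrow> flow 0 v = F 1 - F v"
proof -
  assume v: "v \<in> {0..1}"
  have "terminal_solution 0 (\<lambda>v. F 1 - F v)"
    unfolding terminal_solution_def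
    using primF_deriv_within by (auto intro!: derivative_eq_intros)
  then show ?thesis using terminal_solution_eq_flow[of 0 _ v] v by fastforce
qed

text \<open>Where the terminal solution is negative its derivative is \<open>- f < 0\<close>, so it could not return
  to \<open>0\<close> at the right end.\<close>

lemma flow_nonneg_right:
  assumes c: "c \<ge> 0" and s: "0 \<le> s" and pos: "\<And>x. s < x \<Longrightarrow> x < 1 \<Longrightarrow> f x > 0"
    and v: "s \<le> v" "v \<le> 1"
  shows "flow c v \<ge> 0"
proof (rule ccontr)
  assume neg: "\<not> flow c v \<ge> 0"
  define D where "D x = - flow c x" for x
  have "D v \<le> D 1"
  proof (rule le_of_deriv_nonneg_where_positive[where D = D])
    show "continuous_on {v..1} D"
      unfolding D_def using s v by (intro continuous_intros continuous_flow c) auto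
    fix x assume x: "v < x" "x < 1" "D x > 0"
    have "(D has_real_derivative - (c * a * R (max 0 (flow c x)) - f x)) (at x)"
      unfolding D_def using x s v by (intro DERIV_minus flow_deriv c) auto
    moreover have "max 0 (flow c x) = 0" using x by (simp add: D_def)
    ultimately show "\<exists>d\<ge>0. (D has_real_derivative d) (at x)"
      using pos[of x] x v by (intro exI[of _ "f x"]) auto
  qed (use neg v in \<open>auto simp: D_def\<close>)
  then show False using neg flow_1[OF c] by (simp add: D_def)
qed

text \<open>A zero of \<open>flow c\<close> in \<open>(s,1)\<close> would be a local minimum with derivative \<open>- f v < 0\<close>.\<close>

lemma flow_pos_right:
  assumes c: "c \<ge> 0" and s: "0 \<le> s" and pos: "\<And>x. s < x \<Longrightarrow> x < 1 \<Longrightarrow> f x > 0"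
    and v: "s < v" "v < 1"
  shows "flow c v > 0"
proof (rule ccontr)
  assume "\<not> flow c v > 0"
  then have zero: "flow c v = 0"
    using flow_nonneg_right[OF c s pos, of v] v by simp
  have "flow c v \<le> flow c x" if "\<bar>v - x\<bar> < min (v - s) (1 - v)" for x
    using flow_nonneg_right[OF c s pos, of x] zero that by auto
  then have "c * a * R (max 0 (flow c v)) - f v = 0"
    using s v by (intro DERIV_local_min[OF flow_deriv[OF c], of _ "min (v - s) (1 - v)"]) auto
  then show False using zero pos[OF v] by simp
qed

section \<open>Admissible speeds in terms of the terminal value solutions\<close>

lemma solves_bvp_imp_terminal_solution:
  assumes "solves_bvp a b f c y"
  shows "terminal_solution c y"
proof -
  have "max 0 (y v) = y v" if "v \<in> {0..1}" for v
    using assms that by (cases "v = 0"; cases "v = 1") (auto simp: solves_bvp_def less_imp_le)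
  then show ?thesis
    using assms by (simp add: solves_bvp_def terminal_solution_def Rfun_def)
qed

lemma admissible_speed_iff_flow:
  assumes c: "c \<ge> 0"
  shows "admissible_speed a b f c \<longleftrightarrow> flow c 0 = 0 \<and> (\<forall>v\<in>{0<..<1}. flow c v > 0)"
proof
  assume "admissible_speed a b f c"
  then obtain y where y: "solves_bvp a b f c y"
    by (auto simp: admissible_speed_def)
  have "y v = flow c v" if "v \<in> {0..1}" for v
    by (rule terminal_solution_eq_flow[OF c solves_bvp_imp_terminal_solution[OF y] that])
  then show "flow c 0 = 0 \<and> (\<forall>v\<in>{0<..<1}. flow c v > 0)"
    using y by (fastforce simp: solves_bvp_def)
next
  assume *: "flow c 0 = 0 \<and> (\<forall>v\<in>{0<..<1}. flow c v > 0)"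
  have "max 0 (flow c v) = flow c v" if "v \<in> {0..1}" for v
    using * that flow_1[OF c] by (cases "v = 0"; cases "v = 1") (auto simp: less_imp_le)
  then have "solves_bvp a b f c (flow c)"
    using * flow[OF c] by (simp add: solves_bvp_def terminal_solution_def Rfun_def)
  then show "admissible_speed a b f c"
    by (auto simp: admissible_speed_def)
qed

lemma admissible_speed_nonneg:
  assumes F1: "F 1 \<ge> 0" and c: "admissible_speed a b f c"
  shows "c \<ge> 0"
proof (rule ccontr)
  assume neg: "\<not> c \<ge> 0"
  obtain y where y: "solves_bvp a b f c y"
    using c by (auto simp: admissible_speed_def)
  note ty = solves_bvp_imp_terminal_solution[OF y]
  have "y 1 + F 1 < y 0 + F 0"
  proof (rule DERIV_neg_imp_decreasing_open[where f = "\<lambda>x. y x + F x"])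
    show "continuous_on {0..1} (\<lambda>x. y x + F x)"
      by (intro continuous_intros terminal_solution_continuous[OF ty] continuous_primF) auto
    fix x :: real assume x: "0 < x" "x < 1"
    have "((\<lambda>x. y x + F x) has_real_derivative c * a * R (max 0 (y x)) - f x + f x) (at x)"
      using x by (intro DERIV_add terminal_solution_deriv[OF ty] primF_deriv) auto
    moreover have "y x > 0" using y x by (simp add: solves_bvp_def)
    then have "c * a * R (max 0 (y x)) < 0"
      using neg a R_pos[of "y x"] by (simp add: mult_neg_pos)
    ultimately show "\<exists>d. ((\<lambda>x. y x + F x) has_real_derivative d) (at x) \<and> d < 0"
      by auto
  qed auto
  then show False using y F1 by (simp add: solves_bvp_def primF_0)
qed

lemma rect_flow_deriv:
  assumes "c \<ge> 0" "0 < x" "x < 1" "flow c x > 0"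
  shows "((\<lambda>x. rect (flow c x)) has_real_derivative c - f x / (a * R (flow c x))) (at x)"
proof -
  have "((\<lambda>x. rect (flow c x)) has_real_derivative
      1 / (a * R (flow c x)) * (c * a * R (max 0 (flow c x)) - f x)) (at x)"
    by (rule DERIV_chain2[OF rect_deriv flow_deriv]) (use assms in auto)
  moreover have "1 / (a * R (flow c x)) * (c * a * R (max 0 (flow c x)) - f x) = c - f x / (a * R (flow c x))"
    using assms a R_pos[of "flow c x"] by (simp add: field_simps)
  ultimately show ?thesis by simp
qed

lemma continuous_rect_flow:
  assumes "c \<ge> 0" "S \<subseteq> {0..1}"
  shows "continuous_on S (\<lambda>x. rect (flow c x))"
  by (rule continuous_on_compose2[OF continuous_rect[of UNIV] continuous_flow[OF assms]]) simp

end

section \<open>Positive reaction terms\<close>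

text \<open>The barrier \<open>w\<close> is a subsolution of \<open>z' = c - q * (1 / z + b)\<close>: its derivative in \<open>x\<close> is
  \<open>c / (2 * S)\<close>. The hypothesis on \<open>q\<close> amounts to \<open>b * x * sqrt (q / x) \<le> S - 1\<close>, after
  completing a square.\<close>

lemma barrier_inequality:
  fixes b c q x :: real
  assumes pos: "b > 0" "c > 0" "x > 0" and q: "q \<ge> 0" and le: "b * q + 2 * sqrt (q / x) \<le> c"
  defines "S \<equiv> sqrt (1 + b * c * x)"
  defines "w \<equiv> (S - 1) / b"
  shows "w > 0" and "c / (2 * S) + q * (1 / w + b) \<le> c"
proof -
  have S2: "S\<^sup>2 = 1 + b * c * x" using pos by (simp add: S_def)
  have S1: "S > 1" using pos by (simp add: S_def)
  then show "w > 0" using pos by (simp add: w_def)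
  define r where "r = sqrt (q / x)"
  have r: "r \<ge> 0" and r2: "q = r\<^sup>2 * x" using q pos by (simp_all add: r_def)
  have "(b * x) * (b * q + 2 * r) \<le> (b * x) * c"
    using le pos by (intro mult_left_mono) (auto simp: r_def)
  then have "(b * x * r + 1)\<^sup>2 \<le> S\<^sup>2"
    unfolding S2 r2 by (simp add: power2_eq_square algebra_simps)
  then have "b * x * r + 1 \<le> S"
    using S1 by (auto dest: power2_le_imp_le)
  then have "(b * x * r)\<^sup>2 \<le> (S - 1)\<^sup>2"
    using pos r by (intro power_mono) auto
  then have bq: "q * b \<le> (S - 1)\<^sup>2 / (b * x)"
    using pos unfolding r2 by (simp add: field_simps power2_eq_square)
  have "q * (1 / w + b) = q * b * (S / (S - 1))"
    using S1 pos by (simp add: w_def field_simps)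
  also have "\<dots> \<le> (S - 1)\<^sup>2 / (b * x) * (S / (S - 1))"
    using bq S1 by (intro mult_right_mono) auto
  also have "\<dots> = (S - 1) * S / (b * x)"
    using S1 by (simp add: power2_eq_square)
  finally have 1: "q * (1 / w + b) \<le> (S - 1) * S / (b * x)" .
  have c: "c = (S - 1) * (S + 1) / (b * x)"
    using S2 pos by (simp add: field_simps power2_eq_square)
  have "c / (2 * S) = (S - 1) / (b * x) * ((S + 1) / (2 * S))"
    unfolding c by simp
  also have "\<dots> \<le> (S - 1) / (b * x) * 1"
    using S1 pos by (intro mult_left_mono) auto
  finally have 2: "c / (2 * S) \<le> (S - 1) / (b * x)" by simp
  have "c / (2 * S) + q * (1 / w + b) \<le> (S - 1) / (b * x) + (S - 1) * S / (b * x)"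
    using 1 2 by linarith
  also have "\<dots> = c"
    unfolding c by (simp add: add_divide_distrib[symmetric] algebra_simps)
  finally show "c / (2 * S) + q * (1 / w + b) \<le> c" .
qed

text \<open>Reaction terms of type A.\<close>

locale positive_reaction = reaction_bvp +
  assumes f_pos: "\<And>x. 0 < x \<Longrightarrow> x < 1 \<Longrightarrow> f x > 0"
begin

lemma primF_pos: "0 < v \<Longrightarrow> v \<le> 1 \<Longrightarrow> F v > 0"
  using primF_less[of 0 v] f_pos by (simp add: primF_0)

lemma admissible_speed_iff: "admissible_speed a b f c \<longleftrightarrow> c \<ge> 0 \<and> flow c 0 = 0"
proof -
  have "\<forall>v\<in>{0<..<1}. flow c v > 0" if "c \<ge> 0"
    using flow_pos_right[OF that order_refl f_pos] by simp
  moreover have "admissible_speed a b f c \<Longrightarrow> c \<ge> 0"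
    using admissible_speed_nonneg primF_pos[of 1] by simp
  ultimately show ?thesis
    using admissible_speed_iff_flow by blast
qed

lemma rect_primF_le:
  assumes adm: "admissible_speed a b f c" and v: "0 < v" "v \<le> 1"
  shows "rect (F v) \<le> c * v"
proof -
  have c: "c \<ge> 0" and y0: "flow c 0 = 0"
    using adm by (auto simp: admissible_speed_iff)
  have nonneg: "flow c x \<ge> 0" if "0 \<le> x" "x \<le> 1" for x
    using flow_nonneg_right[OF c order_refl f_pos] that by auto
  let ?G = "\<lambda>x. flow c x + F x"
  let ?D = "\<lambda>x. rect (?G x) - c * x"
  have "?D v \<le> ?D 0"
  proof (rule DERIV_nonpos_imp_decreasing_open[where f = ?D])
    show "0 \<le> v" using v by simp
    show "continuous_on {0..v} ?D"
      using v by (intro continuous_intros continuous_on_compose2[OF continuous_rect[of UNIV]]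
          continuous_flow c continuous_primF) auto
    fix x assume x: "0 < x" "x < v"
    have le: "flow c x \<le> ?G x" and pos: "?G x > 0"
      using primF_pos[of x] nonneg[of x] x v by auto
    have "(?G has_real_derivative c * a * R (max 0 (flow c x)) - f x + f x) (at x)"
      using x v by (intro DERIV_add flow_deriv c primF_deriv) auto
    then have "(?G has_real_derivative c * a * R (flow c x)) (at x)"
      using nonneg[of x] x v by (simp add: max_def)
    then have "(?D has_real_derivative 1 / (a * R (?G x)) * (c * a * R (flow c x)) - c * 1) (at x)"
      using pos by (intro DERIV_diff DERIV_cmult DERIV_ident DERIV_chain2[OF rect_deriv]) auto
    moreover have "1 / (a * R (?G x)) * (c * a * R (flow c x)) \<le> c"
    proof -
      have "c * (R (flow c x) / R (?G x)) \<le> c * 1"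
        using le nonneg[of x] x v R_pos[OF pos] c by (intro mult_left_mono) (auto intro: R_mono)
      then show ?thesis using a by simp
    qed
    ultimately show "\<exists>d. (?D has_real_derivative d) (at x) \<and> d \<le> 0"
      by (intro exI conjI) auto
  qed
  then have "rect (?G v) \<le> c * v" using y0 by (simp add: primF_0)
  moreover have "rect (F v) \<le> rect (?G v)"
    using nonneg[of v] primF_pos[of v] v by (intro rect_le) auto
  ultimately show ?thesis by simp
qed

text \<open>If \<open>flow c 0\<close> were positive, \<open>rect (flow c)\<close> would start above the barrier \<open>w\<close> and stay
  above it up to \<open>v = 1\<close>, where it vanishes while \<open>w\<close> is positive.\<close>

lemma admissible_speed_of_pointwise_bound:
  assumes c: "\<And>v. 0 < v \<Longrightarrow> v < 1 \<Longrightarrow> b / a * f v + 2 * sqrt (f v / (a * v)) \<le> c"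
  shows "admissible_speed a b f c"
proof -
  have "0 < b / a * f (1/2)" "0 \<le> sqrt (f (1/2) / (a * (1/2)))"
    using a b f_pos[of "1/2"] by auto
  then have c0: "c > 0" using c[of "1/2"] by linarith
  have nonneg: "flow c 0 \<ge> 0"
    using flow_nonneg_right[of c 0 0] f_pos c0 by simp
  define w where "w x = (sqrt (1 + b * c * x) - 1) / b" for x
  define D where "D x = rect (flow c x) - w x" for x
  have w_arg: "1 + b * c * x > 0" if "0 \<le> x" for x
    using that b c0 by (intro add_pos_nonneg) auto
  have "flow c 0 = 0"
  proof (rule ccontr)
    assume "flow c 0 \<noteq> 0"
    then have D0: "D 0 > 0"
      using nonneg rect_less[of 0 "flow c 0"] by (simp add: D_def w_def)
    have "D 0 \<le> D 1"
    proof (rule le_of_deriv_nonneg_where_positive[where D = D])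
      show "continuous_on {0..1} D"
        unfolding D_def w_def using c0 b
        by (intro continuous_intros continuous_rect_flow) auto
      fix x :: real assume x: "0 < x" "x < 1" "D x > 0"
      have y: "flow c x > 0"
        using flow_pos_right[of c 0 x] f_pos c0 x by auto
      have q: "f x / a \<ge> 0" using f_pos[of x] x a by simp
      have *: "b * (f x / a) + 2 * sqrt (f x / a / x) \<le> c"
        using c[of x] x by simp
      note bar = barrier_inequality[OF b c0 x(1) q *]
      have w: "w x > 0" using bar(1) by (simp add: w_def)
      have "1 / R (flow c x) \<le> 1 / rect (flow c x) + b"
        by (rule inverse_R_le[OF y])
      also have "1 / rect (flow c x) \<le> 1 / w x"
        using w x by (intro divide_left_mono) (auto simp: D_def)
      finally have "f x / a * (1 / R (flow c x)) \<le> f x / a * (1 / w x + b)"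
        using q by (intro mult_left_mono) auto
      then have le: "f x / (a * R (flow c x)) + c / (2 * sqrt (1 + b * c * x)) \<le> c"
        using bar(2) by (simp add: w_def)
      have "(w has_real_derivative c / (2 * sqrt (1 + b * c * x))) (at x)"
        unfolding w_def using w_arg[of x] x b
        by (auto intro!: derivative_eq_intros simp: field_simps)
      then have "(D has_real_derivative c - f x / (a * R (flow c x)) - c / (2 * sqrt (1 + b * c * x))) (at x)"
        unfolding D_def using c0 x y by (intro DERIV_diff rect_flow_deriv) auto
      then show "\<exists>d\<ge>0. (D has_real_derivative d) (at x)"
        using le by (intro exI conjI) auto
    qed (use D0 in auto)
    moreover have "w 1 > 0"
      using b c0 by (simp add: w_def)
    ultimately show False
      using D0 flow_1[of c] c0 by (simp add: D_def)
  qed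
  then show ?thesis
    using c0 by (simp add: admissible_speed_iff)
qed

lemma admissible_speeds_half_line:
  assumes "admissible_speed a b f c\<^sub>0"
  obtains cstar where "{c. admissible_speed a b f c} = {cstar..}"
proof
  define A where "A = {c. admissible_speed a b f c}"
  have A_eq: "A = {0..} \<inter> (\<lambda>c. flow c 0) -` {0}"
    by (auto simp: A_def admissible_speed_iff)
  have "closed A"
    unfolding A_eq by (intro continuous_closed_preimage continuous_flow_in_speed) auto
  moreover have "A \<noteq> {}" using assms by (auto simp: A_def)
  moreover have bdd: "bdd_below A" by (auto simp: A_eq intro: bdd_belowI[of _ 0])
  ultimately have inA: "Inf A \<in> A" by (rule closed_contains_Inf[rotated 2])
  have "c \<in> A" if "c \<ge> Inf A" for c
  proof -
    have c: "0 \<le> Inf A" "0 \<le> c" and 0: "flow (Inf A) 0 = 0"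
      using inA that by (auto simp: A_eq)
    have "flow c 0 \<le> 0"
      using flow_antimono[of "Inf A" c 0] c that 0 by simp
    moreover have "flow c 0 \<ge> 0"
      using flow_nonneg_right[of c 0 0] c f_pos by simp
    ultimately show ?thesis using c by (simp add: A_eq)
  qed
  moreover have "Inf A \<le> c" if "c \<in> A" for c
    by (rule cInf_lower[OF that bdd])
  ultimately have "A = {Inf A..}"
    by (intro set_eqI iffI) (simp_all only: atLeast_iff)
  then show "{c. admissible_speed a b f c} = {Inf A..}"
    unfolding A_def[symmetric] .
qed

end

section \<open>Reaction terms that are nonpositive near the origin\<close>

text \<open>The common features of types B and C. The last assumption concerns only the balanced case
  \<open>F 1 = 0\<close>, in which the admissible speed is \<open>0\<close>; it is vacuous for type B.\<close>

locale sign_changing_reaction = reaction_bvp +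
  fixes \<alpha> :: real
  assumes alpha: "0 < \<alpha>" "\<alpha> < 1"
    and f_nonpos: "\<And>x. 0 < x \<Longrightarrow> x < \<alpha> \<Longrightarrow> f x \<le> 0"
    and f_pos: "\<And>x. \<alpha> < x \<Longrightarrow> x < 1 \<Longrightarrow> f x > 0"
    and F_1_nonneg: "F 1 \<ge> 0"
    and F_neg: "\<And>v. F 1 = 0 \<Longrightarrow> 0 < v \<Longrightarrow> v \<le> \<alpha> \<Longrightarrow> F v < 0"
begin

lemma gain_pos: "F 1 - F \<alpha> > 0"
  using primF_less[of \<alpha> 1] alpha f_pos by simp

lemma flow_mono_left:
  assumes c: "c \<ge> 0" and st: "0 \<le> s" "s \<le> t" "t \<le> \<alpha>"
  shows "flow c s \<le> flow c t"
proof (rule DERIV_nonneg_imp_increasing_open[where f = "flow c", OF st(2)])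
  show "continuous_on {s..t} (flow c)"
    using st alpha by (intro continuous_flow c) auto
  fix x assume x: "s < x" "x < t"
  have "c * a * R (max 0 (flow c x)) \<ge> 0"
    using c a by (intro mult_nonneg_nonneg R_nonneg) auto
  then show "\<exists>d. (flow c has_real_derivative d) (at x) \<and> 0 \<le> d"
    using flow_deriv[OF c, of x] f_nonpos[of x] x st alpha
    by (intro exI[of _ "c * a * R (max 0 (flow c x)) - f x"]) auto
qed

lemma flow_nonneg:
  assumes c: "c \<ge> 0" and y0: "flow c 0 \<ge> 0" and v: "v \<in> {0..1}"
  shows "flow c v \<ge> 0"
proof (cases "v \<le> \<alpha>")
  case True
  then show ?thesis using flow_mono_left[OF c, of 0 v] y0 v by simp
next
  case False
  then show ?thesis
    using flow_nonneg_right[OF c _ f_pos, of v] alpha v by simp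
qed

lemma flow_le_gain:
  assumes c: "c \<ge> 0" and v: "v \<in> {0..1}"
  shows "flow c v \<le> F 1 - F \<alpha>"
proof (cases "v \<le> \<alpha>")
  case True
  then have "flow c v \<le> flow c \<alpha>" using flow_mono_left[OF c, of v \<alpha>] v by simp
  also have "\<dots> \<le> F 1 - F \<alpha>"
    using flow_plus_primF_mono[OF c, of \<alpha> 1] alpha flow_1[OF c] by simp
  finally show ?thesis .
next
  case False
  then have "flow c v \<le> F 1 - F v"
    using flow_plus_primF_mono[OF c, of v 1] v flow_1[OF c] by simp
  moreover have "F \<alpha> < F v"
    using False primF_less[of \<alpha> v] f_pos alpha v by simp
  ultimately show ?thesis by simp
qed

lemma speed_mul_le_rect:
  assumes c: "c \<ge> 0" and y0: "flow c 0 \<ge> 0" and v: "0 \<le> v" "v \<le> \<alpha>"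
    and pos: "\<And>x. 0 < x \<Longrightarrow> x < v \<Longrightarrow> flow c x > 0"
  shows "c * v \<le> rect (flow c v)"
proof -
  let ?D = "\<lambda>x. rect (flow c x) - c * x"
  have "?D 0 \<le> ?D v"
  proof (rule DERIV_nonneg_imp_increasing_open[where f = ?D, OF v(1)])
    show "continuous_on {0..v} ?D"
      using v alpha by (intro continuous_intros continuous_rect_flow c) auto
    fix x assume x: "0 < x" "x < v"
    have "(?D has_real_derivative c - f x / (a * R (flow c x)) - c * 1) (at x)"
      using x v alpha by (intro DERIV_diff rect_flow_deriv DERIV_cmult DERIV_ident c pos) auto
    moreover have "f x / (a * R (flow c x)) \<le> 0"
      using f_nonpos[of x] x v a R_pos[OF pos[OF x]] by (intro divide_nonpos_pos) auto
    ultimately show "\<exists>d. (?D has_real_derivative d) (at x) \<and> 0 \<le> d"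
      by (intro exI conjI) auto
  qed
  then show ?thesis
    using rect_le[of 0 "flow c 0"] y0 by simp
qed

lemma admissible_speedD:
  assumes "admissible_speed a b f c"
  shows "c \<ge> 0" "flow c 0 = 0" "\<And>v. 0 < v \<Longrightarrow> v < 1 \<Longrightarrow> flow c v > 0"
  using admissible_speed_nonneg[OF F_1_nonneg assms] assms admissible_speed_iff_flow[of c] by auto

text \<open>On \<open>[0,\<alpha>]\<close> the two profiles satisfy \<open>flow c' \<le> flow c\<close>, because \<open>flow\<close> is nonincreasing in
  the speed. As \<open>f \<le> 0\<close> there, \<open>rect (flow c')\<close> nevertheless outgrows \<open>rect (flow c)\<close>.\<close>

lemma admissible_speed_not_less:
  assumes c: "admissible_speed a b f c" and c': "admissible_speed a b f c'"
  shows "\<not> c < c'"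
proof
  assume less: "c < c'"
  note y = admissible_speedD[OF c] and y' = admissible_speedD[OF c']
  have le: "flow c' x \<le> flow c x" if "0 \<le> x" "x \<le> 1" for x
    using flow_antimono[of c c' x] y(1) less that by simp
  let ?D = "\<lambda>x. rect (flow c' x) - rect (flow c x) - (c' - c) * x"
  have "?D 0 \<le> ?D \<alpha>"
  proof (rule DERIV_nonneg_imp_increasing_open[where f = ?D])
    show "0 \<le> \<alpha>" using alpha by simp
    show "continuous_on {0..\<alpha>} ?D"
      using alpha by (intro continuous_intros continuous_rect_flow y(1) y'(1)) auto
    fix x assume x: "0 < x" "x < \<alpha>"
    have Rle: "R (flow c' x) \<le> R (flow c x)" and Rpos: "R (flow c' x) > 0"
      using le[of x] y'(3)[of x] x alpha by (auto intro!: R_mono R_pos)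
    have "(?D has_real_derivative (c' - f x / (a * R (flow c' x))) - (c - f x / (a * R (flow c x)))
        - (c' - c) * 1) (at x)"
      using x alpha by (intro DERIV_diff rect_flow_deriv DERIV_cmult DERIV_ident y y') auto
    moreover have "- f x / (a * R (flow c x)) \<le> - f x / (a * R (flow c' x))"
      using f_nonpos[OF x] Rle Rpos a by (intro divide_left_mono mult_left_mono) auto
    ultimately show "\<exists>d. (?D has_real_derivative d) (at x) \<and> 0 \<le> d"
      by (intro exI conjI) auto
  qed
  moreover have "rect (flow c' \<alpha>) \<le> rect (flow c \<alpha>)"
    using le[of \<alpha>] y'(3)[of \<alpha>] alpha by (intro rect_le) auto
  moreover have "(c' - c) * \<alpha> > 0" using less alpha by simp
  ultimately show False using y(2) y'(2) by simp
qed

lemma admissible_speed_exists: "\<exists>c. admissible_speed a b f c"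
proof -
  \<comment> \<open>The condition \<open>c * v \<le> rect (flow c v)\<close>, and not just \<open>flow c 0 \<ge> 0\<close>, is needed when \<open>f = 0\<close> on
    \<open>[0,\<alpha>]\<close>: then \<open>flow c\<close> vanishes near \<open>0\<close> for all large \<open>c\<close>.\<close>
  define A where "A = {c. 0 \<le> c \<and> (\<forall>v\<in>{0..\<alpha>}. flow c v \<ge> 0 \<and> c * v \<le> rect (flow c v))}"
  have A_eq: "A = {0..} \<inter> (\<Inter>v\<in>{0..\<alpha>}. ({0..} \<inter> (\<lambda>c. flow c v) -` {0..})
      \<inter> ({0..} \<inter> (\<lambda>c. rect (flow c v) - c * v) -` {0..}))"
    by (auto simp: A_def)
  have "closed (({0..} \<inter> (\<lambda>c. flow c v) -` {0..})
      \<inter> ({0..} \<inter> (\<lambda>c. rect (flow c v) - c * v) -` {0..}))" if "v \<in> {0..\<alpha>}" for v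
  proof (rule closed_Int; rule continuous_closed_preimage)
    have v: "v \<in> {0..1}" using alpha that by simp
    show cf: "continuous_on {0..} (\<lambda>c. flow c v)"
      by (rule continuous_flow_in_speed[OF v])
    show "continuous_on {0..} (\<lambda>c. rect (flow c v) - c * v)"
      by (intro continuous_intros continuous_on_compose2[OF continuous_rect[of UNIV] cf] subset_UNIV)
  qed auto
  then have closed: "closed A"
    unfolding A_eq by (intro closed_Int[OF closed_atLeast] closed_INT ballI)
  have F_le: "F v \<le> F 1" if "0 \<le> v" "v \<le> \<alpha>" for v
    using flow_plus_primF_mono[of 0 v 1] flow_mono_left[of 0 0 v] that alpha F_1_nonneg
      flow_0[of 0] flow_0[of v] by (simp add: primF_0)
  have "0 \<in> A"
    using F_le alpha rect_le[of 0] by (auto simp: A_def flow_0)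
  then have ne: "A \<noteq> {}" by auto
  have bdd: "bdd_above A"
  proof (rule bdd_aboveI)
    fix c assume "c \<in> A"
    then have c: "c \<ge> 0" "flow c \<alpha> \<ge> 0" "c * \<alpha> \<le> rect (flow c \<alpha>)"
      using alpha by (auto simp: A_def)
    have "rect (flow c \<alpha>) \<le> rect (F 1 - F \<alpha>)"
      using flow_le_gain[of c \<alpha>] c alpha by (intro rect_le) auto
    then show "c \<le> rect (F 1 - F \<alpha>) / \<alpha>"
      using c(3) alpha by (simp add: field_simps)
  qed
  define s where "s = Sup A"
  have "s \<in> A" unfolding s_def by (rule closed_contains_Sup[OF ne bdd closed])
  then have s: "s \<ge> 0" "\<And>v. v \<in> {0..\<alpha>} \<Longrightarrow> flow s v \<ge> 0 \<and> s * v \<le> rect (flow s v)"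
    by (auto simp: A_def)
  have y0: "flow s 0 = 0"
  proof (rule ccontr)
    assume "flow s 0 \<noteq> 0"
    then have "flow s 0 > 0" using s(2)[of 0] alpha by simp
    \<comment> \<open>By continuity \<open>flow c 0 > 0\<close> for some \<open>c > s\<close>, and this already forces \<open>c \<in> A\<close>.\<close>
    have "continuous_on {0..} (\<lambda>c. flow c 0)"
      by (rule continuous_flow_in_speed) auto
    then obtain d where d: "d > 0" "\<And>c. c \<ge> 0 \<Longrightarrow> dist c s < d \<Longrightarrow> dist (flow c 0) (flow s 0) < flow s 0"
      using \<open>flow s 0 > 0\<close> s(1) unfolding continuous_on_iff by fastforce
    define c where "c = s + d / 2"
    have c: "c \<ge> 0" "c > s" using d s by (auto simp: c_def)
    have pos0: "flow c 0 > 0"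
      using d(2)[of c] c d(1) by (auto simp: c_def dist_real_def)
    have pos: "flow c v > 0" if "v \<in> {0..\<alpha>}" for v
      using flow_mono_left[OF c(1), of 0 v] pos0 that by simp
    have "c * v \<le> rect (flow c v)" if "v \<in> {0..\<alpha>}" for v
    proof (rule speed_mul_le_rect[OF c(1)])
      show "flow c 0 \<ge> 0" using pos0 by simp
      show "flow c x > 0" if "0 < x" "x < v" for x
        using pos[of x] that \<open>v \<in> {0..\<alpha>}\<close> by simp
    qed (use that in auto)
    then have "c \<in> A" using pos c by (auto simp: A_def less_imp_le)
    then show False using cSup_upper[OF _ bdd, of c] c by (simp add: s_def)
  qed
  have "flow s v > 0" if v: "0 < v" "v < 1" for v
  proof (cases "v \<le> \<alpha>")
    case False
    then show ?thesis using flow_pos_right[OF s(1), of \<alpha> v] f_pos alpha v by simp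
  next
    case True
    show ?thesis
    proof (cases "s = 0")
      case True
      have "F 1 = 0" using y0 flow_0[of 0] True by (simp add: primF_0)
      then show ?thesis
        using F_neg[of v] v \<open>v \<le> \<alpha>\<close> True flow_0[of v] by simp
    next
      case False
      have "s * v > 0" using False s(1) v by simp
      then have "flow s v \<noteq> 0" using s(2)[of v] v \<open>v \<le> \<alpha>\<close> by auto
      then show ?thesis using s(2)[of v] v \<open>v \<le> \<alpha>\<close> by auto
    qed
  qed
  then have "admissible_speed a b f s"
    using y0 by (simp add: admissible_speed_iff_flow[OF s(1)])
  then show ?thesis ..
qed

lemma admissible_speed_unique:
  obtains cstar where "{c. admissible_speed a b f c} = {cstar}"
  using admissible_speed_exists admissible_speed_not_less
  by (metis (mono_tags, lifting) Collect_cong linorder_neqE_linordered_idom singleton_conv)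

lemma primF_le_speed:
  assumes adm: "admissible_speed a b f c" and v: "0 < v" "v \<le> 1"
  shows "F v \<le> c * a * R (F 1 - F \<alpha>) * v"
proof -
  note y = admissible_speedD[OF adm]
  let ?D = "\<lambda>x. c * a * R (F 1 - F \<alpha>) * x - (flow c x + F x)"
  have "?D 0 \<le> ?D v"
  proof (rule DERIV_nonneg_imp_increasing_open[where f = ?D])
    show "0 \<le> v" using v by simp
    show "continuous_on {0..v} ?D"
      using v by (intro continuous_intros continuous_flow continuous_primF y(1)) auto
    fix x assume x: "0 < x" "x < v"
    have "(?D has_real_derivative c * a * R (F 1 - F \<alpha>) * 1 - (c * a * R (max 0 (flow c x)) - f x + f x)) (at x)"
      using x v by (intro DERIV_diff DERIV_add DERIV_cmult DERIV_ident flow_deriv primF_deriv y(1)) auto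
    moreover have "c * a * R (max 0 (flow c x)) \<le> c * a * R (F 1 - F \<alpha>)"
      using y(1) a flow_le_gain[OF y(1), of x] gain_pos x v by (intro mult_left_mono R_mono) auto
    ultimately show "\<exists>d. (?D has_real_derivative d) (at x) \<and> 0 \<le> d"
      by (intro exI conjI) auto
  qed
  then show ?thesis
    using flow_nonneg[OF y(1), of v] y(2) v by (simp add: primF_0)
qed

lemma admissible_speed_le:
  assumes adm: "admissible_speed a b f c"
  shows "c * \<alpha> \<le> rect (F 1 - F \<alpha>)"
proof -
  note y = admissible_speedD[OF adm]
  have "c * \<alpha> \<le> rect (flow c \<alpha>)"
    using y alpha by (intro speed_mul_le_rect) auto
  also have "\<dots> \<le> rect (F 1 - F \<alpha>)"
    using flow_le_gain[OF y(1), of \<alpha>] y(3)[of \<alpha>] alpha by (intro rect_le) auto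
  finally show ?thesis .
qed

end

theorem proposition3:
  fixes a b k :: real and f :: "real \<Rightarrow> real"
  assumes "a > 0" and "b > 0"
    and "continuous_on {0..1} f" and "f 0 = 0" and "f 1 = 0"
    and "k > 0"
    and "\<forall>s\<in>{0..1}. \<bar>f s\<bar> \<le> k * s \<and> \<bar>f s\<bar> \<le> k * (1 - s)"
  shows
    "(type_A f \<longrightarrow>
       (\<exists>cstar. {c. admissible_speed a b f c} = {cstar..} \<and>
          sqrt (SUP v\<in>{0<..1}. b\<^sup>2 / a\<^sup>2 * ((primF f v)\<^sup>2 / v\<^sup>2) + 2 / a * (primF f v / v\<^sup>2)) \<le> cstar \<and>
          cstar \<le> (SUP v\<in>{0<..1}. b / a * f v + 2 * sqrt (f v / (a * v)))))
     \<and>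
     (\<forall>\<alpha>. type_B f \<alpha> \<or> type_C f \<alpha> \<longrightarrow>
       (\<exists>cstar. {c. admissible_speed a b f c} = {cstar} \<and>
          1 / Rfun a b (primF f 1 - primF f \<alpha>) * (SUP v\<in>{0<..1}. primF f v / (a * v)) \<le> cstar \<and>
          cstar \<le> 1 / \<alpha> * sqrt (b\<^sup>2 / a\<^sup>2 * (primF f 1 - primF f \<alpha>)\<^sup>2
                                 + 2 / a * (primF f 1 - primF f \<alpha>))))"
proof (intro conjI allI impI)
  interpret reaction_bvp a b f
    using assms by unfold_locales
  {
    assume A: "type_A f"
    interpret positive_reaction a b f
      using A by unfold_locales (auto simp: type_A_def)
    define M where "M = (SUP v\<in>{0<..1}. b / a * f v + 2 * sqrt (f v / (a * v)))"
    have bdd: "bdd_above ((\<lambda>v. b / a * f v + 2 * sqrt (f v / (a * v))) ` {0<..1})"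
    proof (rule bdd_aboveI2)
      fix v :: real assume v: "v \<in> {0<..1}"
      then have k: "f v \<le> k * v" using assms(7) by (force simp: abs_le_iff)
      have "k * v \<le> k * 1" using v assms(6) by (intro mult_left_mono) auto
      then have "b / a * f v \<le> b / a * k"
        using k a b by (intro mult_left_mono) auto
      moreover have "f v / (a * v) \<le> k / a"
        using k v a by (simp add: field_simps)
      then have "sqrt (f v / (a * v)) \<le> sqrt (k / a)" by simp
      ultimately show "b / a * f v + 2 * sqrt (f v / (a * v)) \<le> b / a * k + 2 * sqrt (k / a)"
        by linarith
    qed
    have adm_M: "admissible_speed a b f M"
      unfolding M_def by (intro admissible_speed_of_pointwise_bound cSUP_upper bdd) auto
    obtain cstar where cstar: "{c. admissible_speed a b f c} = {cstar..}"
      by (rule admissible_speeds_half_line[OF adm_M])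
    then have adm: "admissible_speed a b f cstar" by auto
    then have c0: "cstar \<ge> 0" by (simp add: admissible_speed_iff)
    have "(SUP v\<in>{0<..1}. b\<^sup>2 / a\<^sup>2 * ((F v)\<^sup>2 / v\<^sup>2) + 2 / a * (F v / v\<^sup>2)) \<le> cstar\<^sup>2"
    proof (rule cSUP_least)
      fix v :: real assume v: "v \<in> {0<..1}"
      then have "F v > 0" by (simp add: primF_pos)
      then have "b\<^sup>2 / a\<^sup>2 * ((F v)\<^sup>2 / v\<^sup>2) + 2 / a * (F v / v\<^sup>2) = (rect (F v))\<^sup>2 / v\<^sup>2"
        by (simp add: rect_power2 add_divide_distrib)
      also have "\<dots> \<le> (cstar * v)\<^sup>2 / v\<^sup>2"
        using rect_primF_le[OF adm, of v] rect_le[of 0 "F v"] v \<open>F v > 0\<close>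
        by (intro divide_right_mono power_mono) auto
      finally show "b\<^sup>2 / a\<^sup>2 * ((F v)\<^sup>2 / v\<^sup>2) + 2 / a * (F v / v\<^sup>2) \<le> cstar\<^sup>2"
        using v by (simp add: power_mult_distrib)
    qed auto
    then have "sqrt (SUP v\<in>{0<..1}. b\<^sup>2 / a\<^sup>2 * ((F v)\<^sup>2 / v\<^sup>2) + 2 / a * (F v / v\<^sup>2)) \<le> cstar"
      using c0 by (intro real_le_lsqrt) auto
    moreover have "cstar \<le> M" using cstar adm_M by auto
    ultimately show "\<exists>cstar. {c. admissible_speed a b f c} = {cstar..} \<and>
          sqrt (SUP v\<in>{0<..1}. b\<^sup>2 / a\<^sup>2 * ((primF f v)\<^sup>2 / v\<^sup>2) + 2 / a * (primF f v / v\<^sup>2)) \<le> cstar \<and>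
          cstar \<le> (SUP v\<in>{0<..1}. b / a * f v + 2 * sqrt (f v / (a * v)))"
      using cstar unfolding M_def by blast
  }
  {
    fix \<alpha> assume BC: "type_B f \<alpha> \<or> type_C f \<alpha>"
    then have alpha: "0 < \<alpha>" "\<alpha> < 1" and pos: "\<And>x. \<alpha> < x \<Longrightarrow> x < 1 \<Longrightarrow> f x > 0"
      and nonpos: "\<And>x. 0 < x \<Longrightarrow> x < \<alpha> \<Longrightarrow> f x \<le> 0"
      by (auto simp: type_B_def type_C_def less_imp_le)
    have gain: "F \<alpha> < F 1"
      using alpha pos by (intro primF_less) auto
    have "F 1 \<ge> 0 \<and> (F 1 = 0 \<longrightarrow> (\<forall>v. 0 < v \<and> v \<le> \<alpha> \<longrightarrow> F v < 0))"
      using BC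
    proof
      assume B: "type_B f \<alpha>"
      then have "integral {0..\<alpha>} f = integral {0..\<alpha>} (\<lambda>x. 0)"
        by (intro integral_cong) (auto simp: type_B_def)
      then show ?thesis using gain by (simp add: primF_def)
    next
      assume C: "type_C f \<alpha>"
      have "F v < F 0" if v: "0 < v" "v \<le> \<alpha>" for v
      proof (rule DERIV_neg_imp_decreasing_open[OF v(1)])
        show "continuous_on {0..v} F" using v alpha by (intro continuous_primF) auto
        show "\<exists>d. (F has_real_derivative d) (at x) \<and> d < 0" if "0 < x" "x < v" for x
          using primF_deriv[of x] C that v alpha by (auto simp: type_C_def)
      qed
      then show ?thesis using C by (auto simp: type_C_def primF_def)
    qed
    then interpret sign_changing_reaction a b f \<alpha>
      using alpha pos nonpos by unfold_locales auto
    obtain cstar where cstar: "{c. admissible_speed a b f c} = {cstar}"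
      by (rule admissible_speed_unique)
    then have adm: "admissible_speed a b f cstar" by auto
    define G where "G = F 1 - F \<alpha>"
    have G: "G > 0" using gain_pos by (simp add: G_def)
    have "(SUP v\<in>{0<..1}. F v / (a * v)) \<le> cstar * R G"
    proof (rule cSUP_least)
      fix v :: real assume "v \<in> {0<..1}"
      then show "F v / (a * v) \<le> cstar * R G"
        using primF_le_speed[OF adm, of v] a by (simp add: field_simps G_def)
    qed auto
    then have "1 / R G * (SUP v\<in>{0<..1}. F v / (a * v)) \<le> cstar"
      using R_pos[OF G] by (simp add: field_simps)
    moreover have "cstar \<le> 1 / \<alpha> * sqrt (b\<^sup>2 / a\<^sup>2 * G\<^sup>2 + 2 / a * G)"
    proof -
      have "sqrt (b\<^sup>2 / a\<^sup>2 * G\<^sup>2 + 2 / a * G) = rect G"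
        using G rect_le[of 0 G] by (subst rect_power2[symmetric]) auto
      then show ?thesis
        using admissible_speed_le[OF adm] alpha by (simp add: field_simps G_def)
    qed
    ultimately show "\<exists>cstar. {c. admissible_speed a b f c} = {cstar} \<and>
          1 / Rfun a b (primF f 1 - primF f \<alpha>) * (SUP v\<in>{0<..1}. primF f v / (a * v)) \<le> cstar \<and>
          cstar \<le> 1 / \<alpha> * sqrt (b\<^sup>2 / a\<^sup>2 * (primF f 1 - primF f \<alpha>)\<^sup>2
                                 + 2 / a * (primF f 1 - primF f \<alpha>))"
      using cstar unfolding G_def by blast
  }
qed

end
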